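(* Let $\le$ be a binary relation on a set $S$ and let $\Upsilon,\Theta\subseteq S^S$. If $\sqsubseteq$ is an augmentation of $\le$ that is $(\Upsilon,\Theta)$-correct, then $\sqsubseteq$ is an augmentation of $\le^{\mathrm{cor}}_{\Upsilon,\Theta}$.
   Context: $S^S$ is the set of all functions $S\to S$. A relation $\sqsubseteq$ on $S$ is an augmentation of a relation $\preceq$ on $S$ if $\preceq$ is a subset of $\sqsubseteq$. A relation $\preceq$ on $S$ is $(\Upsilon,\Theta)$-correct if for all $p,q\in S$ with $p\not\preceq q$ there is $\sigma\in\Upsilon$ such that $\tau(\sigma(p))\not\preceq\tau(\sigma(q))$ for all $\tau\in\Theta$. The $(\Upsilon,\Theta)$-corrective augmentation of $\le$ is defined by: $p\le^{\mathrm{cor}}_{\Upsilon,\Theta}q$ iff $p\le q$ or for every $\sigma\in\Upsilon$ there is $\tau\in\Theta$ with $\tau(\sigma(p))\le\tau(\sigma(q))$. *)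

theory Defs
  imports Main "HOL-Library.FuncSet"
begin

text \<open>Binary relations on a set \<open>S\<close> are sets \<open>r \<subseteq> S \<times> S\<close>; the set \<open>S\<^sup>S\<close> of all functions
  from \<open>S\<close> to \<open>S\<close> is rendered as the extensional function space \<open>S \<rightarrow>\<^sub>E S\<close>.\<close>

definition augmentation :: "'a rel \<Rightarrow> 'a rel \<Rightarrow> bool" where
  \<comment> \<open>The first argument is an augmentation of the second.\<close>
  "augmentation r' r \<longleftrightarrow> r \<subseteq> r'"

definition correct :: "'a set \<Rightarrow> ('a \<Rightarrow> 'a) set \<Rightarrow> ('a \<Rightarrow> 'a) set \<Rightarrow> 'a rel \<Rightarrow> bool" where
  "correct S \<Upsilon> \<Theta> r \<longleftrightarrow>
     (\<forall>p\<in>S. \<forall>q\<in>S. (p, q) \<notin> r \<longrightarrow> (\<exists>\<sigma>\<in>\<Upsilon>. \<forall>\<tau>\<in>\<Theta>. (\<tau> (\<sigma> p), \<tau> (\<sigma> q)) \<notin> r))"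

definition corrective_augmentation ::
    "'a set \<Rightarrow> ('a \<Rightarrow> 'a) set \<Rightarrow> ('a \<Rightarrow> 'a) set \<Rightarrow> 'a rel \<Rightarrow> 'a rel" where
  "corrective_augmentation S \<Upsilon> \<Theta> r =
     {(p, q) \<in> S \<times> S. (p, q) \<in> r \<or> (\<forall>\<sigma>\<in>\<Upsilon>. \<exists>\<tau>\<in>\<Theta>. (\<tau> (\<sigma> p), \<tau> (\<sigma> q)) \<in> r)}"

end

theory Submission
  imports Defs
begin

theorem lemma3p85:
  fixes S :: "'a set" and le ext :: "'a rel" and \<Upsilon> \<Theta> :: "('a \<Rightarrow> 'a) set"
  assumes "le \<subseteq> S \<times> S"
    and "\<Upsilon> \<subseteq> S \<rightarrow>\<^sub>E S" and "\<Theta> \<subseteq> S \<rightarrow>\<^sub>E S"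
    and "ext \<subseteq> S \<times> S"
    and "augmentation ext le"
    and "correct S \<Upsilon> \<Theta> ext"
  shows "augmentation ext (corrective_augmentation S \<Upsilon> \<Theta> le)"
  \<comment> \<open>Suppose \<open>(p, q)\<close> is in the corrective augmentation but not in
    \<open>ext\<close>. As \<open>le\<close> lies in \<open>ext\<close>, \<open>(p, q)\<close> is
    not in \<open>le\<close>. Correctness of \<open>ext\<close> yields one \<sigma> that no \<tau>
    in \<Theta> repairs in \<open>ext\<close>; yet the second disjunct gives, for this \<sigma>, a
    \<tau> that repairs it in \<open>le\<close>, hence in \<open>ext\<close>.\<close>
  using assms(5,6) unfolding augmentation_def correct_def corrective_augmentation_def by blast

end
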